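(* Let $S$ be an affine semigroup minimally generated by $\mathcal{A}=\{\mathbf{a}_1,\ldots,\mathbf{a}_p\}\subset\mathbb{N}^r$ ($p$ distinct elements), and let $\mathbf{d}\in S$ be nonzero. If $\mathrm{Betti}(S)=\{\mathbf{d}\}$, then (a) $\mathcal{C}_\mathcal{A}$ is a presentation of $S$; (b) $S$ is the gluing of $\#\mathsf{Z}(\mathbf{d})$ free affine semigroups; (c) $S$ is a complete intersection.
   Context: $\mathbb{N}$ denotes the nonnegative integers. An affine semigroup is a finitely generated submonoid of $\mathbb{N}^r$ for some positive integer $r$. $S$ is minimally generated by $\mathcal{A}$ if $S=\mathbb{N}\mathbf{a}_1+\cdots+\mathbb{N}\mathbf{a}_p$ and no proper subset of $\mathcal{A}$ generates $S$. An affine semigroup is free if it is isomorphic as a monoid to $\mathbb{N}^s$ for some $s$. The factorization homomorphism is $\pi_\mathcal{A}:\mathbb{N}^p\to S$, $\mathbf{u}=(u_1,\ldots,u_p)\mapsto\sum_{i=1}^p u_i\mathbf{a}_i$; for $\mathbf{a}\in S$, $\mathsf{Z}(\mathbf{a})=\pi_\mathcal{A}^{-1}(\mathbf{a})$ is its set of factorizations. The kernel congruence $\equiv_\mathcal{A}$ is the set of pairs $(\mathbf{u},\mathbf{v})\in\mathbb{N}^p\times\mathbb{N}^p$ with $\pi_\mathcal{A}(\mathbf{u})=\pi_\mathcal{A}(\mathbf{v})$. A presentation of $S$ is a set $\sigma\subseteq\mathbb{N}^p\times\mathbb{N}^p$ such that $\equiv_\mathcal{A}$ is the least congruence on $\mathbb{N}^p$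 containing $\sigma$; it is minimal if no proper subset of it generates $\equiv_\mathcal{A}$ as a congruence. $\mathrm{Betti}(S)=\{\pi_\mathcal{A}(\mathbf{u})\mid(\mathbf{u},\mathbf{v})\in\sigma\}$ for a minimal presentation $\sigma$ of $S$; this set is known not to depend on the choice of $\sigma$. All minimal presentations of $S$ have the same cardinality, denoted $\nu(S)$. Let $A$ be the $r\times p$ matrix with columns $\mathbf{a}_1,\ldots,\mathbf{a}_p$; it is known that $\nu(S)\ge p-\mathrm{rank}(A)$, and $S$ is a complete intersection if equality holds. Circuits: for $\mathbf{u}\in\mathbb{N}^p$ let $\mathrm{supp}(\mathbf{u})=\{i\mid u_i\neq0\}$. $\mathcal{C}_\mathcal{A}$ is the set of nonzero $(\mathbf{u},\mathbf{v})\in{\equiv_\mathcal{A}}$ such that $\mathbf{u}$ and $\mathbf{v}$ have disjoint supports, $\mathrm{supp}(\mathbf{u})\cup\mathrm{supp}(\mathbf{v})$ is minimal with respect to inclusion (among all such unions for nonzero pairs of $\equiv_\mathcal{A}$ with disjoint supports), and the coordinates of $(\mathbf{u},\mathbf{v})$ are relatively prime (their overall gcd is $1$). Gluing: let $T$ be an affine semigroup with minimal generating set $\mathcal{B}\subset\mathbb{N}^r$, and let $\mathcal{B}=\mathcal{B}_1\cup\mathcal{B}_2$ with $\mathcal{B}_1,\mathcal{B}_2$ disjoint and nonempty, generating $T_1$ and $T_2$. $T$ is the gluing of $T_1$ and $T_2$ if there is $\mathbf{g}\in (T_1\cap T_2)\setminus\{0\}$ with $\mathbb{Z}\mathcal{B}_1\cap\mathbb{Z}\mathcal{B}_2=\mathbb{Z}\mathbf{g}$,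 where $\mathbb{Z}\mathcal{B}_i$ is the subgroup of $\mathbb{Z}^r$ generated by $\mathcal{B}_i$. Gluing of $n\ge 2$ semigroups is understood by iteration: $S$ is the gluing of $S_1,\ldots,S_n$ if there is a partition $\mathcal{A}=\mathcal{A}_1\cup\cdots\cup\mathcal{A}_n$ into disjoint nonempty subsets such that $S_i$ is generated by $\mathcal{A}_i$ and, for every $i\in\{1,\ldots,n-1\}$, the semigroup generated by $\mathcal{A}_i\cup\cdots\cup\mathcal{A}_n$ is the gluing of $S_i$ and the semigroup generated by $\mathcal{A}_{i+1}\cup\cdots\cup\mathcal{A}_n$. *)

theory Defs
  imports "HOL-Analysis.Analysis" "HOL-Computational_Algebra.Group_Closure"
begin

text \<open>
  Elements of \<open>\<nat>\<^sup>r\<close> and \<open>\<nat>\<^sup>p\<close> are vectors of type \<^typ>\<open>nat ^ 'r\<close> and \<^typ>\<open>nat ^ 'p\<close>;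
  a generating set \<open>{a\<^sub>1, \<dots>, a\<^sub>p}\<close> is given by its enumeration \<open>a :: 'p \<Rightarrow> nat ^ 'r\<close>.
\<close>

definition submonoid :: "'a::comm_monoid_add set \<Rightarrow> bool" where
  "submonoid M \<longleftrightarrow> 0 \<in> M \<and> (\<forall>x\<in>M. \<forall>y\<in>M. x + y \<in> M)"

definition affine_semigroup :: "(nat ^ 'r) set \<Rightarrow> bool" where
  "affine_semigroup S \<longleftrightarrow> (\<exists>B. finite B \<and> S = submonoid hull B)"

definition minimally_generates :: "(nat ^ 'r) set \<Rightarrow> (nat ^ 'r) set \<Rightarrow> bool" where
  "minimally_generates B S \<longleftrightarrow>
     submonoid hull B = S \<and> (\<forall>C. C \<subset> B \<longrightarrow> submonoid hull C \<noteq> S)"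

text \<open>Carrier of \<open>\<nat>\<^sup>s\<close>, needed with \<open>s\<close> as a bound variable; addition is pointwise.\<close>

definition nat_pow :: "nat \<Rightarrow> (nat \<Rightarrow> nat) set" where
  "nat_pow s = {u. \<forall>i\<ge>s. u i = 0}"

definition free_affine_semigroup :: "(nat ^ 'r) set \<Rightarrow> bool" where
  "free_affine_semigroup T \<longleftrightarrow> affine_semigroup T \<and>
     (\<exists>s f. bij_betw f (nat_pow s) T \<and> f (\<lambda>i. 0) = 0 \<and>
        (\<forall>u\<in>nat_pow s. \<forall>v\<in>nat_pow s. f (\<lambda>i. u i + v i) = f u + f v))"

definition factorization_hom :: "('p::finite \<Rightarrow> nat ^ 'r) \<Rightarrow> nat ^ 'p \<Rightarrow> nat ^ 'r" where
  "factorization_hom a u = (\<Sum>i\<in>UNIV. u $ i *s a i)"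

definition factorizations :: "('p::finite \<Rightarrow> nat ^ 'r) \<Rightarrow> nat ^ 'r \<Rightarrow> (nat ^ 'p) set" where
  "factorizations a x = {u. factorization_hom a u = x}"

definition kernel_congruence :: "('p::finite \<Rightarrow> nat ^ 'r) \<Rightarrow> ((nat ^ 'p) \<times> (nat ^ 'p)) set" where
  "kernel_congruence a = {(u, v). factorization_hom a u = factorization_hom a v}"

definition congruence :: "('a::comm_monoid_add \<times> 'a) set \<Rightarrow> bool" where
  "congruence R \<longleftrightarrow> equiv UNIV R \<and> (\<forall>u v w. (u, v) \<in> R \<longrightarrow> (u + w, v + w) \<in> R)"

definition presentation ::
    "('p::finite \<Rightarrow> nat ^ 'r) \<Rightarrow> ((nat ^ 'p) \<times> (nat ^ 'p)) set \<Rightarrow> bool" where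
  "presentation a \<sigma> \<longleftrightarrow> congruence hull \<sigma> = kernel_congruence a"

definition minimal_presentation ::
    "('p::finite \<Rightarrow> nat ^ 'r) \<Rightarrow> ((nat ^ 'p) \<times> (nat ^ 'p)) set \<Rightarrow> bool" where
  "minimal_presentation a \<sigma> \<longleftrightarrow>
     presentation a \<sigma> \<and> (\<forall>\<tau>. \<tau> \<subset> \<sigma> \<longrightarrow> \<not> presentation a \<tau>)"

text \<open>
  Minimal presentations of an affine semigroup exist, are finite, and all have the same
  cardinality and the same set of values \<open>\<pi>(u)\<close>; so the choices made by \<open>SOME\<close> below are
  immaterial.
\<close>

definition betti :: "('p::finite \<Rightarrow> nat ^ 'r) \<Rightarrow> (nat ^ 'r) set" where
  "betti a = (let \<sigma> = (SOME \<sigma>. minimal_presentation a \<sigma>)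
              in {factorization_hom a u | u v. (u, v) \<in> \<sigma>})"

definition min_pres_card :: "('p::finite \<Rightarrow> nat ^ 'r) \<Rightarrow> nat" where
  "min_pres_card a = card (SOME \<sigma>. minimal_presentation a \<sigma>)"

definition generator_matrix :: "('p::finite \<Rightarrow> nat ^ 'r) \<Rightarrow> real ^ 'p ^ 'r" where
  "generator_matrix a = (\<chi> i j. real (a j $ i))"

definition complete_intersection :: "('p::finite \<Rightarrow> nat ^ 'r) \<Rightarrow> bool" where
  "complete_intersection a \<longleftrightarrow>
     int (min_pres_card a) = int CARD('p) - int (rank (generator_matrix a))"

definition supp :: "nat ^ 'p \<Rightarrow> 'p set" where
  "supp u = {i. u $ i \<noteq> 0}"

definition disjoint_kernel_pairs ::
    "('p::finite \<Rightarrow> nat ^ 'r) \<Rightarrow> ((nat ^ 'p) \<times> (nat ^ 'p)) set" where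
  "disjoint_kernel_pairs a =
     {(u, v). (u, v) \<in> kernel_congruence a \<and> (u, v) \<noteq> (0, 0) \<and> supp u \<inter> supp v = {}}"

definition circuits :: "('p::finite \<Rightarrow> nat ^ 'r) \<Rightarrow> ((nat ^ 'p) \<times> (nat ^ 'p)) set" where
  "circuits a =
     {(u, v). (u, v) \<in> disjoint_kernel_pairs a \<and>
        (\<forall>(u', v')\<in>disjoint_kernel_pairs a. \<not> supp u' \<union> supp v' \<subset> supp u \<union> supp v) \<and>
        Gcd (range (\<lambda>i. u $ i) \<union> range (\<lambda>i. v $ i)) = 1}"

definition int_vec :: "nat ^ 'r \<Rightarrow> int ^ 'r" where
  "int_vec x = (\<chi> i. int (x $ i))"

definition is_gluing :: "(nat ^ 'r) set \<Rightarrow> (nat ^ 'r) set \<Rightarrow> (nat ^ 'r) set \<Rightarrow> bool" where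
  "is_gluing T T1 T2 \<longleftrightarrow> affine_semigroup T \<and>
     (\<exists>B1 B2. minimally_generates (B1 \<union> B2) T \<and> B1 \<inter> B2 = {} \<and> B1 \<noteq> {} \<and> B2 \<noteq> {} \<and>
        T1 = submonoid hull B1 \<and> T2 = submonoid hull B2 \<and>
        (\<exists>g \<in> (T1 \<inter> T2) - {0}.
           group_closure (int_vec ` B1) \<inter> group_closure (int_vec ` B2) =
           group_closure {int_vec g}))"

definition is_iterated_gluing ::
    "(nat ^ 'r) set \<Rightarrow> nat \<Rightarrow> (nat \<Rightarrow> (nat ^ 'r) set) \<Rightarrow> bool" where
  "is_iterated_gluing S n T \<longleftrightarrow> 2 \<le> n \<and>
     (\<exists>A. minimally_generates (\<Union>i\<in>{1..n}. A i) S \<and> disjoint_family_on A {1..n} \<and>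
        (\<forall>i\<in>{1..n}. A i \<noteq> {} \<and> T i = submonoid hull (A i)) \<and>
        (\<forall>i\<in>{1..n - 1}.
           is_gluing (submonoid hull (\<Union>j\<in>{i..n}. A j)) (T i)
             (submonoid hull (\<Union>j\<in>{i + 1..n}. A j))))"

end

theory Submission
  imports Defs
begin

text \<open>
  Let \<open>Z\<close> be the set of factorizations of \<open>d\<close>; a minimal presentation \<open>\<sigma>\<close> is contained in
  \<open>Z \<times> Z\<close>. Hence two different factorizations of the same element both lie above some member of
  \<open>Z\<close>. Cancelling a common generator from two members of \<open>Z\<close> would give such a pair in
  a degree not divisible by \<open>d\<close>, so the members of \<open>Z\<close> have pairwise disjoint supports.
  Consequently every pair of distinct members of \<open>Z\<close> is a circuit, and these pairs present \<open>S\<close>.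
  Every relation restricts on the support of \<open>z \<in> Z\<close> to a multiple of \<open>z\<close>, so splitting the
  generators along the supports gives free semigroups glued along \<open>d\<close>; unused generators go
  to the last block. For the complete intersection property, the differences
  \<open>u - v\<close> with \<open>(u, v) \<in> \<sigma>\<close> form a basis of the kernel of \<open>A\<close>: they are independent by
  minimality of \<open>\<sigma>\<close>, and they span the integer kernel, hence by simultaneous Diophantine
  approximation the real one.
\<close>

section \<open>Submonoids and congruences\<close>

lemma submonoid_hull: "submonoid (submonoid hull B)"
  unfolding hull_def submonoid_def by blast

lemma submonoid_sum:
  assumes "submonoid M" "\<And>i. i \<in> I \<Longrightarrow> f i \<in> M"
  shows "sum f I \<in> M"
  using assms(2)
  by (induction I rule: infinite_finite_induct) (use assms(1) in \<open>auto simp: submonoid_def\<close>)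

lemma submonoid_scale:
  fixes x :: "nat ^ 'n::finite"
  assumes "submonoid M" "x \<in> M"
  shows "n *s x \<in> M"
proof (induction n)
  case 0
  have "0 *s x = 0" by (simp add: vec_eq_iff)
  then show ?case using assms(1) by (simp add: submonoid_def)
next
  case (Suc n)
  have "Suc n *s x = x + n *s x" by (simp add: vec_eq_iff)
  then show ?case using assms Suc by (simp add: submonoid_def)
qed

text \<open>If a proper subset \<open>C\<close> of \<open>B\<close> generated as much as
  \<open>B\<close>, then \<open>C \<union> (A - B)\<close> would be a proper subset of
  \<open>A\<close> still generating \<open>S\<close>.\<close>

lemma minimally_generates_subset:
  assumes "minimally_generates A S" "B \<subseteq> A"
  shows "minimally_generates B (submonoid hull B)"
  unfolding minimally_generates_def
proof (intro conjI allI impI refl)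
  fix C assume C: "C \<subset> B"
  show "submonoid hull C \<noteq> submonoid hull B"
  proof
    assume eq: "submonoid hull C = submonoid hull B"
    have "submonoid hull (C \<union> (A - B)) = submonoid hull (B \<union> (A - B))"
      by (metis eq hull_Un_left)
    also have "B \<union> (A - B) = A" using assms(2) by blast
    also have "submonoid hull A = S" using assms(1) by (simp add: minimally_generates_def)
    finally have "submonoid hull (C \<union> (A - B)) = S" .
    moreover have "C \<union> (A - B) \<subset> A" using C assms(2) by blast
    ultimately show False using assms(1) by (simp add: minimally_generates_def)
  qed
qed

text \<open>Every submonoid contains \<open>0\<close> anyway, so a minimal generating set cannot
  afford it.\<close>

lemma minimally_generates_nonzero:
  assumes "minimally_generates A S"
  shows "0 \<notin> A"
proof
  assume "0 \<in> A"
  have "A \<subseteq> submonoid hull (A - {0})"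
    using hull_subset[of "A - {0}" submonoid] submonoid_hull[of "A - {0}"]
    by (auto simp: submonoid_def)
  then have "submonoid hull A \<subseteq> submonoid hull (A - {0})"
    by (rule hull_minimal) (rule submonoid_hull)
  then have "submonoid hull (A - {0}) = S"
    using assms hull_mono[of "A - {0}" A submonoid] by (auto simp: minimally_generates_def)
  moreover have "A - {0} \<subset> A" using \<open>0 \<in> A\<close> by blast
  ultimately show False using assms by (simp add: minimally_generates_def)
qed

section \<open>Congruences on commutative monoids\<close>

lemma congruenceI:
  assumes "\<And>u. (u, u) \<in> R"
    and "\<And>u v. (u, v) \<in> R \<Longrightarrow> (v, u) \<in> R"
    and "\<And>u v w. (u, v) \<in> R \<Longrightarrow> (v, w) \<in> R \<Longrightarrow> (u, w) \<in> R"
    and "\<And>u v w. (u, v) \<in> R \<Longrightarrow> (u + w, v + w) \<in> R"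
  shows "congruence R"
  unfolding congruence_def equiv_def
proof (intro conjI allI impI)
  show "R \<subseteq> UNIV \<times> UNIV" by simp
  show "refl R" using assms(1) by (rule refl_onI)
  show "sym R" using assms(2) by (rule symI)
  show "trans R" using assms(3) by (rule transI)
qed (rule assms(4))

lemma
  assumes "congruence R"
  shows congruence_refl: "(u, u) \<in> R"
    and congruence_sym: "(u, v) \<in> R \<Longrightarrow> (v, u) \<in> R"
    and congruence_trans: "(u, v) \<in> R \<Longrightarrow> (v, w) \<in> R \<Longrightarrow> (u, w) \<in> R"
    and congruence_add: "(u, v) \<in> R \<Longrightarrow> (u + w, v + w) \<in> R"
  using assms unfolding congruence_def equiv_def
  by (auto dest: refl_onD symD transD)

lemma congruence_hull: "congruence (congruence hull R)"
proof (rule congruenceI)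
  fix u v w
  show "(u, w) \<in> congruence hull R"
    if "(u, v) \<in> congruence hull R" "(v, w) \<in> congruence hull R"
    using that unfolding hull_def by (blast intro: congruence_trans)
qed (auto simp: hull_def intro: congruence_refl congruence_sym congruence_add)

lemma congruence_add2:
  assumes "congruence R" "(u, v) \<in> R" "(u', v') \<in> R"
  shows "(u + u', v + v') \<in> R"
proof -
  have "(u + u', v + u') \<in> R" using assms(1,2) by (rule congruence_add)
  moreover have "(u' + v, v' + v) \<in> R" using assms(1,3) by (rule congruence_add)
  ultimately show ?thesis using assms(1) by (metis add.commute congruence_trans)
qed

section \<open>The factorization homomorphism and its kernel\<close>

lemma factorization_hom_add:
  "factorization_hom a (u + v) = factorization_hom a u + factorization_hom a v"
  by (simp add: factorization_hom_def vec_eq_iff distrib_right sum.distrib)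

lemma factorization_hom_zero [simp]: "factorization_hom a 0 = 0"
  by (simp add: factorization_hom_def vec_eq_iff)

lemma factorization_hom_scale: "factorization_hom a (n *s u) = n *s factorization_hom a u"
  by (simp add: factorization_hom_def vec_eq_iff sum_distrib_left mult.assoc)

lemma factorization_hom_axis [simp]: "factorization_hom a (axis i 1) = a i"
  by (simp add: factorization_hom_def vec_eq_iff axis_def if_distrib[of "\<lambda>n. n * _"] cong: if_cong)

lemma congruence_kernel_congruence: "congruence (kernel_congruence a)"
  by (rule congruenceI) (auto simp: kernel_congruence_def factorization_hom_add)

lemma presentation_subset:
  "presentation a \<sigma> \<Longrightarrow> \<sigma> \<subseteq> kernel_congruence a"
  unfolding presentation_def by (metis hull_subset)

section \<open>Existence of minimal presentations\<close>

text \<open>Dickson's lemma, by induction on the coordinate set: elements whose new coordinate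
  is large are dominated already, and the others fall into finitely many level sets.\<close>

lemma dickson:
  fixes f :: "'b \<Rightarrow> 'i \<Rightarrow> nat"
  assumes "finite I"
  shows "\<exists>F\<subseteq>X. finite F \<and> (\<forall>x\<in>X. \<exists>y\<in>F. \<forall>i\<in>I. f y i \<le> f x i)"
  using assms
proof (induction I arbitrary: X)
  case empty
  then show ?case
    by (cases "X = {}") (auto intro!: exI[of _ "{SOME x. x \<in> X}"] some_in_eq[THEN iffD2])
next
  case (insert j I)
  obtain F where F: "F \<subseteq> X" "finite F" "\<And>x. x \<in> X \<Longrightarrow> \<exists>y\<in>F. \<forall>i\<in>I. f y i \<le> f x i"
    using insert.IH[of X] by blast
  \<comment> \<open>The inserted \<open>0\<close> keeps the maximum defined when \<open>F\<close> is
    empty.\<close>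
  define m where "m = Max (insert 0 ((\<lambda>y. f y j) ` F))"
  have m: "f y j \<le> m" if "y \<in> F" for y
    unfolding m_def using F(2) that by (intro Max_ge) auto
  define dominates where "dominates G c \<longleftrightarrow> G \<subseteq> {x \<in> X. f x j = c} \<and> finite G \<and>
      (\<forall>x\<in>{x \<in> X. f x j = c}. \<exists>y\<in>G. \<forall>i\<in>I. f y i \<le> f x i)" for G c
  have "\<forall>c. \<exists>G. dominates G c"
    unfolding dominates_def by (intro allI insert.IH)
  then obtain G where G: "\<And>c. dominates (G c) c" by metis
  have "\<exists>y\<in>F \<union> (\<Union>c<m. G c). \<forall>i\<in>insert j I. f y i \<le> f x i" if x: "x \<in> X" for x
  proof (cases "f x j < m")
    case True
    obtain y where y: "y \<in> G (f x j)" "\<forall>i\<in>I. f y i \<le> f x i"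
      using G[of "f x j"] x unfolding dominates_def by blast
    moreover have "f y j = f x j" using y(1) G[of "f x j"] unfolding dominates_def by blast
    ultimately show ?thesis using True by (intro bexI[of _ y]) auto
  next
    case False
    obtain y where y: "y \<in> F" "\<forall>i\<in>I. f y i \<le> f x i" using F(3)[OF x] by blast
    moreover have "f y j \<le> f x j" using m[OF y(1)] False by linarith
    ultimately show ?thesis by (intro bexI[of _ y]) auto
  qed
  moreover have "F \<union> (\<Union>c<m. G c) \<subseteq> X" using F(1) G unfolding dominates_def by blast
  moreover have "finite (F \<union> (\<Union>c<m. G c))" using F(2) G unfolding dominates_def by auto
  ultimately show ?case by blast
qed

text \<open>The kernel congruence is a submonoid of \<open>\<nat>\<^sup>p \<times> \<nat>\<^sup>p\<close> closed under differences,
  so it is generated by its finitely many minimal nonzero elements.\<close>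

lemma finite_presentation_exists:
  fixes a :: "'p::finite \<Rightarrow> nat ^ 'r"
  shows "\<exists>\<sigma>. finite \<sigma> \<and> presentation a \<sigma>"
proof -
  define X where "X = kernel_congruence a - {(0, 0)}"
  \<comment> \<open>Indexing both components of a pair by one disjoint sum lets Dickson's lemma
    compare them at once.\<close>
  define co :: "(nat ^ 'p) \<times> (nat ^ 'p) \<Rightarrow> 'p + 'p \<Rightarrow> nat"
    where "co = (\<lambda>(u, v). case_sum (($) u) (($) v))"
  obtain F where F: "F \<subseteq> X" "finite F"
      and dom: "\<And>x. x \<in> X \<Longrightarrow> \<exists>y\<in>F. \<forall>i\<in>UNIV. co y i \<le> co x i"
    using dickson[of "UNIV :: ('p + 'p) set" X co] by auto
  define R where "R = congruence hull F"
  have R: "congruence R" unfolding R_def by (rule congruence_hull)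
  \<comment> \<open>Induction measure: subtracting a nonzero pair of \<open>F\<close> lowers the
    total weight.\<close>
  define wt :: "nat ^ 'p \<Rightarrow> nat" where "wt u = (\<Sum>i\<in>UNIV. u $ i)" for u
  have wt_add: "wt (u + v) = wt u + wt v" for u v by (simp add: wt_def sum.distrib)
  have wt_0: "wt u = 0 \<longleftrightarrow> u = 0" for u by (simp add: wt_def vec_eq_iff)
  have "(u, v) \<in> R" if "(u, v) \<in> kernel_congruence a" for u v
    using that
  proof (induction "wt u + wt v" arbitrary: u v rule: less_induct)
    case less
    show ?case
    proof (cases "(u, v) = (0, 0)")
      case True
      then show ?thesis using congruence_refl[OF R] by simp
    next
      case False
      then obtain u1 v1 where uv1: "(u1, v1) \<in> F" and le: "\<forall>i. co (u1, v1) i \<le> co (u, v) i"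
        using dom[of "(u, v)"] less.prems unfolding X_def by auto
      have le1: "u1 $ i \<le> u $ i" "v1 $ i \<le> v $ i" for i
        using le[rule_format, of "Inl i"] le[rule_format, of "Inr i"] by (auto simp: co_def)
      then have uv: "u = u1 + (u - u1)" "v = v1 + (v - v1)" by (auto simp: vec_eq_iff)
      have F1: "(u1, v1) \<in> kernel_congruence a" "(u1, v1) \<noteq> (0, 0)"
        using F(1) uv1 by (auto simp: X_def)
      have "factorization_hom a u1 + factorization_hom a (u - u1)
          = factorization_hom a v1 + factorization_hom a (v - v1)"
        using less.prems uv by (simp add: kernel_congruence_def flip: factorization_hom_add)
      then have "(u - u1, v - v1) \<in> kernel_congruence a"
        using F1(1) by (simp add: kernel_congruence_def)
      moreover have "wt (u - u1) + wt (v - v1) < wt u + wt v"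
      proof -
        have "wt u1 + wt v1 > 0" using F1(2) wt_0[of u1] wt_0[of v1] by auto
        moreover have "wt u = wt u1 + wt (u - u1)" "wt v = wt v1 + wt (v - v1)"
          using wt_add[of u1 "u - u1"] wt_add[of v1 "v - v1"] uv by simp_all
        ultimately show ?thesis by linarith
      qed
      ultimately have "(u - u1, v - v1) \<in> R" by (intro less.hyps)
      moreover have "(u1, v1) \<in> R" unfolding R_def using uv1 by (rule hull_inc)
      ultimately have "(u1 + (u - u1), v1 + (v - v1)) \<in> R" using congruence_add2[OF R] by blast
      then show ?thesis using uv by simp
    qed
  qed
  moreover have "R \<subseteq> kernel_congruence a"
    unfolding R_def using F(1) congruence_kernel_congruence
    by (intro hull_minimal) (auto simp: X_def)
  ultimately show ?thesis using F(2) unfolding presentation_def R_def by auto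
qed

text \<open>A finite presentation has only finitely many subsets, so an inclusion-minimal one among
  those that still present exists. This gives meaning to the \<open>SOME\<close> in
  \<open>betti\<close> and \<open>min_pres_card\<close>.\<close>

lemma minimal_presentation_exists: "\<exists>\<sigma>. minimal_presentation a \<sigma>"
proof -
  obtain \<sigma> where \<sigma>: "finite \<sigma>" "presentation a \<sigma>" using finite_presentation_exists by blast
  define P where "P = {\<tau>. \<tau> \<subseteq> \<sigma> \<and> presentation a \<tau>}"
  have "finite P" "P \<noteq> {}" using \<sigma> by (auto simp: P_def)
  then obtain \<tau> where \<tau>: "\<tau> \<in> P" "\<forall>\<tau>'\<in>P. \<tau>' \<subseteq> \<tau> \<longrightarrow> \<tau> = \<tau>'"
    using finite_has_minimal[of P] by auto
  have "\<not> presentation a \<tau>'" if "\<tau>' \<subset> \<tau>" for \<tau>'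
    using \<tau> that by (auto simp: P_def)
  then show ?thesis using \<tau>(1) by (auto simp: minimal_presentation_def P_def)
qed

section \<open>Presentations in a single degree\<close>

text \<open>The consequence of \<open>betti a = {d}\<close> on which all three claims rest: both
  entries of every relation are factorizations of \<open>d\<close>.\<close>

locale single_degree_presentation =
  fixes a :: "'p::finite \<Rightarrow> nat ^ 'r::finite" and d :: "nat ^ 'r"
    and \<sigma> :: "((nat ^ 'p) \<times> (nat ^ 'p)) set"
  assumes generator_nonzero: "a i \<noteq> 0"
    and degree_nonzero: "d \<noteq> 0"
    and presentation: "presentation a \<sigma>"
    and degree: "\<sigma> \<subseteq> factorizations a d \<times> factorizations a d"
begin

abbreviation "Z \<equiv> factorizations a d"

text \<open>Induction principle for the kernel: a property that forms a congruence spreads from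
  \<open>Z \<times> Z\<close>, which contains the generating set \<open>\<sigma>\<close>, to all
  kernel pairs.\<close>

lemma kernel_subset:
  assumes "congruence R" "\<And>z z'. z \<in> Z \<Longrightarrow> z' \<in> Z \<Longrightarrow> (z, z') \<in> R"
  shows "kernel_congruence a \<subseteq> R"
proof -
  have "\<sigma> \<subseteq> R" using degree assms(2) by auto
  then have "congruence hull \<sigma> \<subseteq> R" using assms(1) by (rule hull_minimal)
  then show ?thesis using presentation by (simp add: presentation_def)
qed

section \<open>Supports of the factorizations of \<open>d\<close>\<close>

lemma hom_Z: "z \<in> Z \<Longrightarrow> factorization_hom a z = d"
  by (simp add: factorizations_def)

text \<open>Being equal, or both lying above members of \<open>Z\<close>, is a congruence that
  contains \<open>Z \<times> Z\<close>.\<close>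

lemma Z_summand:
  assumes "factorization_hom a u = factorization_hom a v" "u \<noteq> v"
  obtains z c where "z \<in> Z" "u = z + c"
proof -
  \<comment> \<open>The monoid ideal generated by \<open>Z\<close>; its closure under addition makes
    the relation below translation invariant.\<close>
  define up where "up = {u. \<exists>z\<in>Z. \<exists>c. u = z + c}"
  have up_add: "u + w \<in> up" if "u \<in> up" for u w
    using that unfolding up_def by (auto simp: add.assoc) (metis add.assoc)
  have "kernel_congruence a \<subseteq> {(u, v). u = v \<or> u \<in> up \<and> v \<in> up}"
  proof (rule kernel_subset)
    show "congruence {(u, v). u = v \<or> u \<in> up \<and> v \<in> up}"
      by (rule congruenceI) (auto simp: up_add)
    show "(z, z') \<in> {(u, v). u = v \<or> u \<in> up \<and> v \<in> up}" if "z \<in> Z" "z' \<in> Z" for z z'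
      using that unfolding up_def by simp (metis add.right_neutral)
  qed
  then have "u \<in> up" using assms by (auto simp: kernel_congruence_def)
  then show ?thesis using that unfolding up_def by blast
qed

text \<open>Cancelling a shared generator \<open>a i\<close> leaves two factorizations of an element
  which, by \<open>Z_summand\<close>, is \<open>d\<close> plus something. Adding \<open>a i\<close>
  back gives \<open>d\<close> again, forcing \<open>a i = 0\<close>.\<close>

lemma Z_supp_disjoint:
  assumes "z \<in> Z" "z' \<in> Z" "z \<noteq> z'"
  shows "supp z \<inter> supp z' = {}"
proof (rule ccontr)
  assume "supp z \<inter> supp z' \<noteq> {}"
  then obtain i where i: "z $ i > 0" "z' $ i > 0" by (auto simp: supp_def)
  define u u' where "u = z - axis i 1" and "u' = z' - axis i 1"
  have eq: "z = u + axis i 1" "z' = u' + axis i 1"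
    using i by (auto simp: u_def u'_def vec_eq_iff axis_def)
  have "factorization_hom a z = factorization_hom a z'" using assms by (simp add: hom_Z)
  then have "factorization_hom a u = factorization_hom a u'"
    unfolding eq factorization_hom_add by simp
  moreover have "u \<noteq> u'" using eq assms(3) by auto
  ultimately obtain w c where w: "w \<in> Z" "u = w + c" by (rule Z_summand)
  have "d = factorization_hom a z" using assms(1) by (simp add: hom_Z)
  also have "\<dots> = factorization_hom a w + factorization_hom a c + a i"
    by (simp add: eq(1) w(2) factorization_hom_add del: One_nat_def)
  also have "factorization_hom a w = d" using w(1) by (rule hom_Z)
  finally have "a i = 0" by (simp add: vec_eq_iff)
  then show False using generator_nonzero by blast
qed

lemma Z_supp_nonempty:
  assumes "z \<in> Z"
  shows "supp z \<noteq> {}"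
proof
  assume "supp z = {}"
  then have "z = 0" by (simp add: supp_def vec_eq_iff)
  then show False using hom_Z[OF assms] degree_nonzero by simp
qed

lemma Z_disjoint_nonmember:
  assumes "z \<in> Z" "z' \<in> Z" "z \<noteq> z'" "i \<in> supp z"
  shows "z' $ i = 0"
  using Z_supp_disjoint[OF assms(1-3)] assms(4) by (auto simp: supp_def)

lemma inj_on_supp_Z: "inj_on supp Z"
  using Z_supp_disjoint Z_supp_nonempty by (intro inj_onI) blast

text \<open>Distinct members have distinct supports, and the finite index type has finitely many
  subsets.\<close>

lemma finite_Z: "finite Z"
  by (rule finite_imageD[OF _ inj_on_supp_Z]) simp

text \<open>Both sides lie above members of \<open>Z\<close>; these differ because the sides have
  disjoint supports and members of \<open>Z\<close> have nonempty ones.\<close>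

lemma disjoint_pair_supp:
  assumes "(u, v) \<in> disjoint_kernel_pairs a"
  obtains z z' where "z \<in> Z" "z' \<in> Z" "z \<noteq> z'" "supp z \<subseteq> supp u" "supp z' \<subseteq> supp v"
proof -
  have uv: "factorization_hom a u = factorization_hom a v" "supp u \<inter> supp v = {}" "u \<noteq> v"
    using assms by (auto simp: disjoint_kernel_pairs_def kernel_congruence_def supp_def vec_eq_iff)
  obtain z c where z: "z \<in> Z" "u = z + c" using uv(1,3) by (rule Z_summand)
  obtain z' c' where z': "z' \<in> Z" "v = z' + c'" using uv(1,3) by (metis Z_summand)
  have sub: "supp z \<subseteq> supp u" "supp z' \<subseteq> supp v"
    using z z' by (auto simp: supp_def)
  moreover have "z \<noteq> z'" using sub uv(2) Z_supp_nonempty[OF z(1)] by blast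
  ultimately show ?thesis using that z(1) z'(1) by blast
qed

section \<open>Pairs of factorizations of \<open>d\<close> as circuits\<close>

lemma Z_pair_disjoint_kernel:
  assumes "z \<in> Z" "z' \<in> Z" "z \<noteq> z'"
  shows "(z, z') \<in> disjoint_kernel_pairs a"
  using assms Z_supp_disjoint[OF assms] degree_nonzero
  by (auto simp: disjoint_kernel_pairs_def kernel_congruence_def hom_Z)

lemma Z_pair_circuit:
  assumes "z \<in> Z" "z' \<in> Z" "z \<noteq> z'"
  shows "(z, z') \<in> circuits a"
proof -
  have minimal: "\<not> supp u \<union> supp v \<subset> supp z \<union> supp z'"
    if uv: "(u, v) \<in> disjoint_kernel_pairs a" for u v
  proof
    assume *: "supp u \<union> supp v \<subset> supp z \<union> supp z'"
    obtain w w' where w: "w \<in> Z" "w' \<in> Z" "w \<noteq> w'" "supp w \<subseteq> supp u" "supp w' \<subseteq> supp v"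
      using uv by (rule disjoint_pair_supp)
    \<comment> \<open>Any third member of \<open>Z\<close> has nonempty support disjoint from those
      of \<open>z\<close> and \<open>z'\<close>, so it does not fit inside their union.\<close>
    have mem: "x \<in> {z, z'}" if x: "x \<in> Z" "supp x \<subseteq> supp z \<union> supp z'" for x
      using Z_supp_nonempty[OF x(1)] x(2) Z_supp_disjoint[OF x(1) assms(1)]
        Z_supp_disjoint[OF x(1) assms(2)] by blast
    have "w \<in> {z, z'}" "w' \<in> {z, z'}" using mem w * by blast+
    then have "{w, w'} = {z, z'}" using w(3) by blast
    then have "supp z \<union> supp z' = supp w \<union> supp w'" by (auto simp: doubleton_eq_iff)
    then have "supp z \<union> supp z' \<subseteq> supp u \<union> supp v" using w(4,5) by blast
    then show False using * by blast
  qed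
  have "Gcd (range (\<lambda>i. z $ i) \<union> range (\<lambda>i. z' $ i)) = 1"
  proof -
    \<comment> \<open>Dividing \<open>z\<close> and \<open>z'\<close> by \<open>g\<close> leaves
      distinct factorizations of one element, so that element is \<open>d\<close> plus something.
      Thus \<open>d\<close> is \<open>g\<close> times a vector above \<open>d\<close>, which forces
      \<open>g \<le> 1\<close>.\<close>
    define g where "g = Gcd (range (\<lambda>i. z $ i) \<union> range (\<lambda>i. z' $ i))"
    have dvd: "g dvd z $ i" "g dvd z' $ i" for i unfolding g_def by (auto intro!: Gcd_dvd)
    define u v where "u = (\<chi> i. z $ i div g)" and "v = (\<chi> i. z' $ i div g)"
    have eq: "z = g *s u" "z' = g *s v"
      using dvd by (auto simp: u_def v_def vec_eq_iff)
    have "g \<noteq> 0"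
    proof
      assume "g = 0"
      then have "z = z'" using eq by (simp add: vec_eq_iff)
      then show False using assms(3) by blast
    qed
    have "g *s factorization_hom a u = g *s factorization_hom a v"
      using assms eq by (metis factorization_hom_scale hom_Z)
    then have "factorization_hom a u = factorization_hom a v"
      using \<open>g \<noteq> 0\<close> by (simp add: vec_eq_iff)
    moreover have "u \<noteq> v" using eq assms(3) by metis
    ultimately obtain w c where w: "w \<in> Z" "u = w + c" by (rule Z_summand)
    have "d = g *s (d + factorization_hom a c)"
      using eq(1) w hom_Z[OF assms(1)] by (metis factorization_hom_add factorization_hom_scale hom_Z)
    then have "g * d $ i \<le> d $ i" for i
      by (metis le_add1 mult_le_mono2 vector_add_component vector_smult_component)
    moreover obtain i where "d $ i \<noteq> 0" using degree_nonzero by (auto simp: vec_eq_iff)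
    ultimately have "g \<le> 1" by (metis mult_le_cancel2 nat_mult_1 neq0_conv)
    with \<open>g \<noteq> 0\<close> have "g = 1" by linarith
    then show ?thesis unfolding g_def .
  qed
  with minimal Z_pair_disjoint_kernel[OF assms] show ?thesis
    unfolding circuits_def by auto
qed

lemma presentation_circuits: "presentation a (circuits a)"
proof -
  have "kernel_congruence a \<subseteq> congruence hull (circuits a)"
  proof (rule kernel_subset[OF congruence_hull])
    fix z z' assume "z \<in> Z" "z' \<in> Z"
    then show "(z, z') \<in> congruence hull (circuits a)"
      using Z_pair_circuit hull_inc congruence_refl[OF congruence_hull] by metis
  qed
  moreover have "congruence hull (circuits a) \<subseteq> kernel_congruence a"
    by (intro hull_minimal congruence_kernel_congruence)
      (auto simp: circuits_def disjoint_kernel_pairs_def)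
  ultimately show ?thesis unfolding presentation_def by blast
qed

text \<open>On \<open>I\<close> every member of \<open>Z\<close> is either \<open>z\<close> itself
  or zero, and having a difference proportional to \<open>z\<close> on \<open>I\<close> is a
  congruence. The multiplier is an integer because differences may be negative.\<close>

lemma kernel_proportional:
  assumes "z \<in> Z" "supp z \<subseteq> I" "\<And>w. w \<in> Z \<Longrightarrow> w \<noteq> z \<Longrightarrow> supp w \<inter> I = {}"
    and "factorization_hom a u = factorization_hom a v"
  obtains c :: int where "\<And>i. i \<in> I \<Longrightarrow> int (u $ i) - int (v $ i) = c * int (z $ i)"
proof -
  let ?R = "{(u, v). \<exists>c. \<forall>i\<in>I. int (u $ i) - int (v $ i) = c * int (z $ i)}"
  have "kernel_congruence a \<subseteq> ?R"
  proof (rule kernel_subset)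
    show "congruence ?R"
    proof (rule congruenceI)
      fix u v w
      show "(u, u) \<in> ?R" by (auto intro: exI[of _ 0])
      show "(v, u) \<in> ?R" if *: "(u, v) \<in> ?R"
      proof -
        obtain c where "\<forall>i\<in>I. int (u $ i) - int (v $ i) = c * int (z $ i)" using * by blast
        then have "\<forall>i\<in>I. int (v $ i) - int (u $ i) = - c * int (z $ i)" by (simp add: algebra_simps)
        then show ?thesis by blast
      qed
      show "(u, w) \<in> ?R" if *: "(u, v) \<in> ?R" "(v, w) \<in> ?R"
      proof -
        obtain c c' where "\<forall>i\<in>I. int (u $ i) - int (v $ i) = c * int (z $ i)"
          "\<forall>i\<in>I. int (v $ i) - int (w $ i) = c' * int (z $ i)" using * by blast
        then have "\<forall>i\<in>I. int (u $ i) - int (w $ i) = (c + c') * int (z $ i)"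
          by (auto simp: algebra_simps)
        then show ?thesis by blast
      qed
      show "(u + w, v + w) \<in> ?R" if "(u, v) \<in> ?R" using that by simp
    qed
    have *: "\<exists>c. \<forall>i\<in>I. int (w $ i) = c * int (z $ i)" if "w \<in> Z" for w
    proof (cases "w = z")
      case True
      then show ?thesis by (auto intro: exI[of _ 1])
    next
      case False
      then have "\<forall>i\<in>I. w $ i = 0" using assms(3)[OF that] by (auto simp: supp_def)
      then show ?thesis by (auto intro: exI[of _ 0])
    qed
    show "(w, w') \<in> ?R" if w: "w \<in> Z" "w' \<in> Z" for w w'
    proof -
      obtain c c' where "\<forall>i\<in>I. int (w $ i) = c * int (z $ i)" "\<forall>i\<in>I. int (w' $ i) = c' * int (z $ i)"
        using * w by meson
      then have "\<forall>i\<in>I. int (w $ i) - int (w' $ i) = (c - c') * int (z $ i)"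
        by (simp add: algebra_simps)
      then show ?thesis by blast
    qed
  qed
  then show ?thesis using that assms(4) unfolding kernel_congruence_def by blast
qed

text \<open>After removing the common part \<open>m\<close>, distinct \<open>u\<close> and
  \<open>v\<close> would contain the supports of two different members of \<open>Z\<close>, but only
  \<open>z\<close> has support meeting \<open>I\<close>.\<close>

lemma kernel_pair_eq:
  assumes "z \<in> Z" "supp z \<subseteq> I" "\<And>w. w \<in> Z \<Longrightarrow> w \<noteq> z \<Longrightarrow> supp w \<inter> I = {}"
    and "supp u \<subseteq> I" "supp v \<subseteq> I"
    and eq: "factorization_hom a u = factorization_hom a v"
  shows "u = v"
proof (rule ccontr)
  assume "u \<noteq> v"
  define m where "m = (\<chi> i. min (u $ i) (v $ i))"
  have uv: "u = (u - m) + m" "v = (v - m) + m" by (auto simp: m_def vec_eq_iff)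
  have "factorization_hom a ((u - m) + m) = factorization_hom a ((v - m) + m)"
    using eq uv by simp
  then have "factorization_hom a (u - m) = factorization_hom a (v - m)"
    by (simp add: factorization_hom_add)
  moreover have "supp (u - m) \<inter> supp (v - m) = {}" by (auto simp: supp_def m_def)
  moreover have "u - m \<noteq> v - m" using uv \<open>u \<noteq> v\<close> by metis
  ultimately have "(u - m, v - m) \<in> disjoint_kernel_pairs a"
    by (auto simp: disjoint_kernel_pairs_def kernel_congruence_def)
  then obtain w w' where w: "w \<in> Z" "w' \<in> Z" "w \<noteq> w'"
    "supp w \<subseteq> supp (u - m)" "supp w' \<subseteq> supp (v - m)"
    by (rule disjoint_pair_supp)
  have "supp (u - m) \<subseteq> I" "supp (v - m) \<subseteq> I" using assms(4,5) by (auto simp: supp_def)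
  then have "supp w \<subseteq> I" "supp w' \<subseteq> I" using w(4,5) by blast+
  then have "w = z" "w' = z"
    using assms(3)[OF w(1)] assms(3)[OF w(2)] Z_supp_nonempty[OF w(1)] Z_supp_nonempty[OF w(2)]
    by blast+
  then show False using w(3) by simp
qed

end

section \<open>Gluings\<close>

text \<open>Lets the semigroup of a block be handled through factorizations supported in that
  block.\<close>

lemma submonoid_hull_image:
  fixes a :: "'p::finite \<Rightarrow> nat ^ 'r::finite"
  shows "submonoid hull (a ` I) = factorization_hom a ` {u. supp u \<subseteq> I}"
proof
  show "submonoid hull (a ` I) \<subseteq> factorization_hom a ` {u. supp u \<subseteq> I}"
  proof (rule hull_minimal)
    show "a ` I \<subseteq> factorization_hom a ` {u. supp u \<subseteq> I}"
    proof
      fix x assume "x \<in> a ` I"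
      then obtain i where i: "i \<in> I" "x = a i" by blast
      have "supp (axis i 1 :: nat ^ 'p) \<subseteq> I" using i(1) by (auto simp: supp_def axis_def)
      moreover have "x = factorization_hom a (axis i 1)"
        unfolding i(2) by (rule factorization_hom_axis[symmetric])
      ultimately show "x \<in> factorization_hom a ` {u. supp u \<subseteq> I}" by blast
    qed
    show "submonoid (factorization_hom a ` {u. supp u \<subseteq> I})"
      unfolding submonoid_def
    proof (intro conjI ballI)
      show "0 \<in> factorization_hom a ` {u. supp u \<subseteq> I}"
        by (rule image_eqI[of _ _ 0]) (auto simp: supp_def)
      fix x y
      assume "x \<in> factorization_hom a ` {u. supp u \<subseteq> I}" "y \<in> factorization_hom a ` {u. supp u \<subseteq> I}"
      then obtain u v where "x = factorization_hom a u" "y = factorization_hom a v"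
        "supp u \<subseteq> I" "supp v \<subseteq> I" by blast
      then show "x + y \<in> factorization_hom a ` {u. supp u \<subseteq> I}"
        by (intro image_eqI[of _ _ "u + v"]) (auto simp: factorization_hom_add supp_def)
    qed
  qed
  show "factorization_hom a ` {u. supp u \<subseteq> I} \<subseteq> submonoid hull (a ` I)"
  proof clarify
    fix u :: "nat ^ 'p" assume u: "supp u \<subseteq> I"
    have H: "submonoid (submonoid hull (a ` I))" by (rule submonoid_hull)
    show "factorization_hom a u \<in> submonoid hull (a ` I)"
      unfolding factorization_hom_def
    proof (rule submonoid_sum[OF H])
      fix i
      show "u $ i *s a i \<in> submonoid hull (a ` I)"
      proof (cases "i \<in> I")
        case True
        then show ?thesis by (intro submonoid_scale[OF H] hull_inc) simp
      next
        case False
        then have "u $ i *s a i = 0" using u by (auto simp: supp_def vec_eq_iff)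
        then show ?thesis using H by (simp add: submonoid_def)
      qed
    qed
  qed
qed

section \<open>Subgroups generated by natural vectors\<close>

lemma int_vec_add: "int_vec (x + y) = int_vec x + int_vec y"
  by (simp add: int_vec_def vec_eq_iff)

lemma int_vec_zero [simp]: "int_vec 0 = 0"
  by (simp add: int_vec_def vec_eq_iff)

lemma int_vec_eq_iff [simp]: "int_vec x = int_vec y \<longleftrightarrow> x = y"
  by (simp add: int_vec_def vec_eq_iff)

lemma group_closure_subset:
  fixes G H :: "'a::ab_group_add set"
  assumes "G \<subseteq> group_closure H"
  shows "group_closure G \<subseteq> group_closure H"
proof
  fix x assume "x \<in> group_closure G"
  then show "x \<in> group_closure H"
    by induction (use assms in \<open>auto intro: group_closure.diff\<close>)
qed

lemma int_scale_group_closure: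
  fixes x :: "int ^ 'n::finite"
  assumes "x \<in> group_closure G"
  shows "c *s x \<in> group_closure G"
proof -
  have nat: "int n *s x \<in> group_closure G" for n
  proof (induction n)
    case (Suc n)
    have "int (Suc n) *s x = x + int n *s x" by (simp add: vec_eq_iff algebra_simps)
    then show ?case using assms Suc group_closure_add by metis
  qed (simp add: vec_eq_iff flip: zero_vec_def)
  show ?thesis
  proof (cases "c \<ge> 0")
    case True
    then show ?thesis using nat[of "nat c"] by simp
  next
    case False
    then have "c *s x = - (int (nat (- c)) *s x)" by (simp add: vec_eq_iff)
    then show ?thesis using nat[of "nat (- c)"] by simp
  qed
qed

lemma int_vec_hull_group_closure:
  assumes "x \<in> submonoid hull B"
  shows "int_vec x \<in> group_closure (int_vec ` B)"
proof -
  have "submonoid hull B \<subseteq> {x. int_vec x \<in> group_closure (int_vec ` B)}"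
    by (rule hull_minimal)
      (auto simp: submonoid_def int_vec_add intro: group_closure.base group_closure_add)
  then show ?thesis using assms by blast
qed

text \<open>Brings group elements back to natural vectors, so that equalities between them become
  kernel pairs once negative terms are moved across.\<close>

lemma group_closure_hull_diff:
  assumes "x \<in> group_closure (int_vec ` B)"
  shows "\<exists>y\<in>submonoid hull B. \<exists>y'\<in>submonoid hull B. x = int_vec y - int_vec y'"
  using assms
proof induction
  case (base s)
  \<comment> \<open>The base case of \<open>group_closure\<close> covers \<open>0\<close> besides
    the generators.\<close>
  have "0 \<in> submonoid hull B" using submonoid_hull[of B] by (simp add: submonoid_def)
  moreover have "\<exists>y\<in>submonoid hull B. s = int_vec y"
    using base calculation int_vec_zero by (metis hull_inc imageE insertE)
  ultimately show ?case using int_vec_zero diff_zero by metis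
next
  case (diff s t)
  then obtain y y' w w' where *: "y \<in> submonoid hull B" "y' \<in> submonoid hull B"
    "w \<in> submonoid hull B" "w' \<in> submonoid hull B"
    "s = int_vec y - int_vec y'" "t = int_vec w - int_vec w'" by blast
  then have "s - t = int_vec (y + w') - int_vec (y' + w)" by (simp add: int_vec_add)
  moreover have "y + w' \<in> submonoid hull B" "y' + w \<in> submonoid hull B"
    using * submonoid_hull[of B] by (auto simp: submonoid_def)
  ultimately show ?case by blast
qed

section \<open>Blocks of generators: gluing along \<open>d\<close> and freeness\<close>

context single_degree_presentation
begin

lemma Z_hull: "z \<in> Z \<Longrightarrow> supp z \<subseteq> I \<Longrightarrow> d \<in> submonoid hull (a ` I)"
  unfolding submonoid_hull_image by (auto simp: hom_Z intro: image_eqI[of _ _ z])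

text \<open>A common element yields a kernel pair \<open>u + v'\<close>, \<open>u' + v\<close>. On
  \<open>I\<close> the \<open>J\<close>-parts vanish, so \<open>u - u'\<close> is an integer
  multiple \<open>c\<close> of \<open>z\<close> there, and the element is \<open>c\<close> times
  \<open>d\<close>.\<close>

lemma group_closure_Int:
  assumes z: "z \<in> Z" "supp z \<subseteq> I" "\<And>w. w \<in> Z \<Longrightarrow> w \<noteq> z \<Longrightarrow> supp w \<inter> I = {}"
    and w: "w \<in> Z" "supp w \<subseteq> J" and disj: "I \<inter> J = {}"
  shows "group_closure (int_vec ` a ` I) \<inter> group_closure (int_vec ` a ` J)
    = group_closure {int_vec d}"
proof
  show "group_closure {int_vec d}
      \<subseteq> group_closure (int_vec ` a ` I) \<inter> group_closure (int_vec ` a ` J)"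
    using Z_hull[OF z(1,2)] Z_hull[OF w]
    by (intro Int_greatest group_closure_subset) (auto intro: int_vec_hull_group_closure)
  show "group_closure (int_vec ` a ` I) \<inter> group_closure (int_vec ` a ` J)
      \<subseteq> group_closure {int_vec d}"
  proof
    fix x assume x: "x \<in> group_closure (int_vec ` a ` I) \<inter> group_closure (int_vec ` a ` J)"
    obtain u u' where u: "supp u \<subseteq> I" "supp u' \<subseteq> I"
      "x = int_vec (factorization_hom a u) - int_vec (factorization_hom a u')"
      using x group_closure_hull_diff[of x "a ` I"] unfolding submonoid_hull_image by blast
    obtain v v' where v: "supp v \<subseteq> J" "supp v' \<subseteq> J"
      "x = int_vec (factorization_hom a v) - int_vec (factorization_hom a v')"
      using x group_closure_hull_diff[of x "a ` J"] unfolding submonoid_hull_image by blast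
    have "int_vec (factorization_hom a (u + v')) = int_vec (factorization_hom a (u' + v))"
      using u(3) v(3) by (simp add: factorization_hom_add int_vec_add algebra_simps)
    then have "factorization_hom a (u + v') = factorization_hom a (u' + v)" by simp
    then obtain c where c: "\<And>i. i \<in> I \<Longrightarrow> int ((u + v') $ i) - int ((u' + v) $ i) = c * int (z $ i)"
      using kernel_proportional[OF z] by blast
    have coord: "int (u $ i) - int (u' $ i) = c * int (z $ i)" for i
    proof (cases "i \<in> I")
      case True
      then have "v $ i = 0" "v' $ i = 0" using v(1,2) disj by (auto simp: supp_def)
      then show ?thesis using c[OF True] by simp
    next
      case False
      then have "u $ i = 0" "u' $ i = 0" "z $ i = 0" using u(1,2) z(2) by (auto simp: supp_def)
      then show ?thesis by simp
    qed
    have "x = c *s int_vec d"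
    proof -
      have "x $ k = c * int (d $ k)" for k
      proof -
        have "x $ k = (\<Sum>i\<in>UNIV. (int (u $ i) - int (u' $ i)) * int (a i $ k))"
          using u(3) by (simp add: int_vec_def factorization_hom_def left_diff_distrib sum_subtractf)
        also have "\<dots> = c * int (factorization_hom a z $ k)"
          by (simp add: coord factorization_hom_def sum_distrib_left mult.assoc)
        finally show ?thesis using z(1) by (simp add: hom_Z)
      qed
      then show ?thesis by (simp add: vec_eq_iff int_vec_def)
    qed
    then show "x \<in> group_closure {int_vec d}"
      using int_scale_group_closure[OF group_closure.base, of "int_vec d" "{int_vec d}" c] by simp
  qed
qed

lemma is_gluing_hull:
  assumes "inj a" "minimally_generates (range a) S"
    and z: "z \<in> Z" "supp z \<subseteq> I" "\<And>w. w \<in> Z \<Longrightarrow> w \<noteq> z \<Longrightarrow> supp w \<inter> I = {}"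
    and w: "w \<in> Z" "supp w \<subseteq> J" and disj: "I \<inter> J = {}"
  shows "is_gluing (submonoid hull (a ` (I \<union> J))) (submonoid hull (a ` I)) (submonoid hull (a ` J))"
  unfolding is_gluing_def
proof (intro conjI exI)
  show "affine_semigroup (submonoid hull (a ` (I \<union> J)))"
    unfolding affine_semigroup_def by (intro exI[of _ "a ` (I \<union> J)"]) simp
  show "minimally_generates (a ` I \<union> a ` J) (submonoid hull (a ` (I \<union> J)))"
    unfolding image_Un[symmetric] using assms(2) by (rule minimally_generates_subset) blast
  show "a ` I \<inter> a ` J = {}" using disj assms(1) by (auto dest: injD)
  show "a ` I \<noteq> {}" "a ` J \<noteq> {}" using z(1,2) w Z_supp_nonempty by blast+
  show "\<exists>g\<in>submonoid hull a ` I \<inter> submonoid hull a ` J - {0}.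
      group_closure (int_vec ` a ` I) \<inter> group_closure (int_vec ` a ` J) = group_closure {int_vec g}"
    using group_closure_Int[OF z w disj] Z_hull[OF z(1,2)] Z_hull[OF w] degree_nonzero
    by (intro bexI[of _ d]) auto
qed simp_all

text \<open>Factorizations within the block are unique by \<open>kernel_pair_eq\<close>, so the rank
  is the number of its generators.\<close>

lemma free_hull:
  assumes z: "z \<in> Z" "supp z \<subseteq> I" "\<And>w. w \<in> Z \<Longrightarrow> w \<noteq> z \<Longrightarrow> supp w \<inter> I = {}"
  shows "free_affine_semigroup (submonoid hull (a ` I))"
proof -
  define s where "s = card I"
  obtain e where e: "bij_betw e {0..<s} I"
    unfolding s_def using ex_bij_betw_nat_finite[of I] by auto
  define e' where "e' = inv_into {0..<s} e"
  have e': "e' i < s" "e (e' i) = i" if "i \<in> I" for i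
    using that e bij_betw_inv_into_right[OF e] bij_betwE[OF bij_betw_inv_into[OF e]]
    by (auto simp: e'_def)
  have e'_e: "e' (e k) = k" "e k \<in> I" if "k < s" for k
    using that bij_betw_inv_into_left[OF e] bij_betwE[OF e] by (auto simp: e'_def)
  \<comment> \<open>\<open>g\<close> places a sequence on the coordinates in \<open>I\<close>, and
    \<open>h\<close> reads it back.\<close>
  define g :: "(nat \<Rightarrow> nat) \<Rightarrow> nat ^ 'p"
    where "g u = (\<chi> i. if i \<in> I then u (e' i) else 0)" for u
  define h :: "nat ^ 'p \<Rightarrow> nat \<Rightarrow> nat" where "h v = (\<lambda>k. if k < s then v $ e k else 0)" for v
  have "bij_betw g (nat_pow s) {u. supp u \<subseteq> I}"
    by (rule bij_betw_byWitness[where f' = h])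
      (auto simp: g_def h_def nat_pow_def supp_def e' e'_e vec_eq_iff fun_eq_iff not_less split: if_splits)
  moreover have "inj_on (factorization_hom a) {u. supp u \<subseteq> I}"
    using kernel_pair_eq[OF z] by (intro inj_onI) blast
  then have "bij_betw (factorization_hom a) {u. supp u \<subseteq> I} (submonoid hull (a ` I))"
    unfolding submonoid_hull_image by (rule inj_on_imp_bij_betw)
  ultimately have bij: "bij_betw (factorization_hom a \<circ> g) (nat_pow s) (submonoid hull (a ` I))"
    by (rule bij_betw_trans)
  have "g (\<lambda>i. 0) = 0" "g (\<lambda>i. u i + v i) = g u + g v" for u v
    by (auto simp: g_def vec_eq_iff)
  then have hom: "(factorization_hom a \<circ> g) (\<lambda>i. 0) = 0"
    "(factorization_hom a \<circ> g) (\<lambda>i. u i + v i) = (factorization_hom a \<circ> g) u + (factorization_hom a \<circ> g) v"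
    for u v
    by (simp_all add: factorization_hom_add)
  have "affine_semigroup (submonoid hull (a ` I))"
    unfolding affine_semigroup_def by (intro exI[of _ "a ` I"]) simp
  then show ?thesis unfolding free_affine_semigroup_def using bij hom by blast
qed

lemma iterated_gluing:
  assumes "inj a" "minimally_generates (range a) S" and card: "2 \<le> card Z"
  shows "\<exists>T. is_iterated_gluing S (card Z) T \<and> (\<forall>i\<in>{1..card Z}. free_affine_semigroup (T i))"
proof -
  define n where "n = card Z"
  obtain zz where zz: "bij_betw zz {1..n} Z"
    unfolding n_def using ex_bij_betw_nat_finite_1[OF finite_Z] by blast
  have zz_Z: "zz k \<in> Z" if "k \<in> {1..n}" for k using bij_betwE[OF zz] that by blast
  \<comment> \<open>Generators occurring in no factorization of \<open>d\<close> join block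
    \<open>n\<close>; the blocks then cover all indices and each still meets the support of just one
    member of \<open>Z\<close>.\<close>
  define I where "I k = supp (zz k) \<union> (if k = n then - (\<Union>z\<in>Z. supp z) else {})" for k
  have supp_I: "supp (zz k) \<subseteq> I k" for k by (simp add: I_def)
  have other: "supp w \<inter> I k = {}" if "k \<in> {1..n}" "w \<in> Z" "w \<noteq> zz k" for k w
    using Z_supp_disjoint[OF that(2) zz_Z[OF that(1)] that(3)] that(2) by (auto simp: I_def)
  have I_disj: "I j \<inter> I k = {}" if "j \<in> {1..n}" "k \<in> {1..n}" "j \<noteq> k" for j k
  proof -
    have "zz j \<noteq> zz k" using zz that by (auto simp: bij_betw_def dest: inj_onD)
    then have "supp (zz j) \<inter> supp (zz k) = {}" using that zz_Z by (intro Z_supp_disjoint) auto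
    then show ?thesis using that zz_Z[of j] zz_Z[of k] by (auto simp: I_def)
  qed
  have I_UNIV: "(\<Union>k\<in>{1..n}. I k) = UNIV"
  proof -
    have "i \<in> (\<Union>k\<in>{1..n}. I k)" for i
    proof (cases "i \<in> (\<Union>z\<in>Z. supp z)")
      case True
      then obtain z where z: "z \<in> Z" "i \<in> supp z" by blast
      then obtain k where "k \<in> {1..n}" "z = zz k"
        using bij_betw_imp_surj_on[OF zz] by (metis imageE)
      then show ?thesis using z(2) supp_I[of k] by blast
    next
      case False
      then have "i \<in> I n" by (simp add: I_def)
      then show ?thesis using card by (intro UN_I[of n]) (auto simp: n_def)
    qed
    then show ?thesis by blast
  qed
  define T where "T k = submonoid hull (a ` I k)" for k
  have "is_iterated_gluing S n T"
    unfolding is_iterated_gluing_def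
  proof (intro conjI exI[of _ "\<lambda>k. a ` I k"] ballI)
    show "2 \<le> n" using card by (simp add: n_def)
    have "(\<Union>i\<in>{1..n}. a ` I i) = range a" using I_UNIV by (metis image_UN)
    then show "minimally_generates (\<Union>i\<in>{1..n}. a ` I i) S" using assms(2) by simp
    show "disjoint_family_on (\<lambda>k. a ` I k) {1..n}"
      unfolding disjoint_family_on_def
    proof (intro ballI impI)
      fix j k assume "j \<in> {1..n}" "k \<in> {1..n}" "j \<noteq> k"
      then show "a ` I j \<inter> a ` I k = {}"
        using I_disj image_Int[OF assms(1), of "I j" "I k"] by simp
    qed
  next
    fix k assume "k \<in> {1..n}"
    then show "a ` I k \<noteq> {}" using supp_I Z_supp_nonempty zz_Z by blast
    show "T k = submonoid hull a ` I k" by (simp add: T_def)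
  next
    fix k assume k: "k \<in> {1..n - 1}"
    let ?J = "\<Union>j\<in>{k + 1..n}. I j"
    have split: "{k..n} = insert k {k + 1..n}" using k by auto
    have U: "(\<Union>j\<in>{k..n}. a ` I j) = a ` (I k \<union> ?J)" unfolding split by blast
    have V: "(\<Union>j\<in>{k + 1..n}. a ` I j) = a ` ?J" by blast
    have kn: "k \<in> {1..n}" "k + 1 \<in> {1..n}" using k by auto
    show "is_gluing (submonoid hull (\<Union>j\<in>{k..n}. a ` I j)) (T k)
        (submonoid hull (\<Union>j\<in>{k + 1..n}. a ` I j))"
      unfolding U V T_def
    proof (rule is_gluing_hull[OF assms(1,2)])
      \<comment> \<open>Since \<open>k \<le> n - 1\<close>, block \<open>k + 1\<close> exists, and
        its factorization of \<open>d\<close> is supported in the union of the later blocks.\<close>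
      show "zz k \<in> Z" "zz (k + 1) \<in> Z" using kn by (simp_all add: zz_Z)
      show "supp (zz k) \<subseteq> I k" by (rule supp_I)
      show "supp w \<inter> I k = {}" if "w \<in> Z" "w \<noteq> zz k" for w using other[OF kn(1)] that by blast
      show "supp (zz (k + 1)) \<subseteq> ?J"
        using supp_I[of "k + 1"] kn(2) by (intro subset_trans[OF _ UN_upper[of "k + 1"]]) auto
      have "I k \<inter> I j = {}" if "j \<in> {k + 1..n}" for j using I_disj[of k j] kn that by simp
      then show "I k \<inter> ?J = {}" by blast
    qed
  qed
  moreover have "free_affine_semigroup (T k)" if "k \<in> {1..n}" for k
    unfolding T_def using zz_Z[OF that] supp_I other[OF that] by (rule free_hull)
  ultimately show ?thesis unfolding n_def by blast
qed

end

section \<open>The number of relations\<close>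

text \<open>The kernel is the orthogonal complement of the row space.\<close>

lemma dim_kernel_add_rank:
  fixes A :: "real ^ 'n ^ 'm"
  shows "dim {x. A *v x = 0} + rank A = CARD('n)"
proof -
  have row: "row i A = A $ i" for i by (simp add: row_def)
  have eq: "{x. A *v x = 0} = {y \<in> UNIV. \<forall>x\<in>span (rows A). orthogonal x y}"
  proof (intro equalityI subsetI)
    fix y assume "y \<in> {x. A *v x = 0}"
    then have row_orthogonal: "orthogonal y x" if "x \<in> rows A" for x
      using that by (auto simp: rows_def row orthogonal_def vec_eq_iff[of "_ *v _"]
          matrix_vector_mul_component inner_commute)
    have "orthogonal y x" if "x \<in> span (rows A)" for x
      using that row_orthogonal by (rule orthogonal_to_span)
    then show "y \<in> {y \<in> UNIV. \<forall>x\<in>span (rows A). orthogonal x y}"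
      by (simp add: orthogonal_commute)
  next
    fix y assume "y \<in> {y \<in> UNIV. \<forall>x\<in>span (rows A). orthogonal x y}"
    then have "orthogonal (row i A) y" for i by (auto simp: rows_def intro: span_base)
    then show "y \<in> {x. A *v x = 0}"
      by (simp add: orthogonal_def vec_eq_iff matrix_vector_mul_component row)
  qed
  show ?thesis
    using dim_subspace_orthogonal_to_vectors[of "span (rows A)" UNIV]
    by (simp add: eq row_rank_def)
qed

text \<open>An integral matrix maps integer vectors to integer vectors. Approximating a multiple
  of a kernel vector simultaneously by integers, the image of the approximation is an integer
  vector of norm less than 1, hence zero.\<close>

lemma kernel_subset_span_integral:
  fixes A :: "real ^ 'n ^ 'm"
  assumes integral: "\<And>i j. A $ i $ j \<in> \<int>"
    and int_kernel: "\<And>h. (\<And>j. h $ j \<in> \<int>) \<Longrightarrow> A *v h = 0 \<Longrightarrow> h \<in> span D"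
  shows "{x. A *v x = 0} \<subseteq> span D"
proof
  fix x assume x: "x \<in> {x. A *v x = 0}"
  obtain e :: "nat \<Rightarrow> 'n" where e: "bij_betw e {0..<CARD('n)} UNIV"
    using ex_bij_betw_nat_finite[of "UNIV :: 'n set"] by auto
  \<comment> \<open>\<open>M\<close> exceeds every absolute row sum, so coordinate errors below
    \<open>1 / N\<close> with \<open>N > M\<close> alter each coordinate of the image by less than
    1.\<close>
  define M where "M = 1 + (\<Sum>i\<in>UNIV. \<Sum>j\<in>UNIV. \<bar>A $ i $ j\<bar>)"
  have M: "M \<ge> 1" "(\<Sum>j\<in>UNIV. \<bar>A $ i $ j\<bar>) < M" for i
  proof -
    show "M \<ge> 1" by (simp add: M_def sum_nonneg)
    have "(\<Sum>j\<in>UNIV. \<bar>A $ i $ j\<bar>) \<le> (\<Sum>i\<in>UNIV. \<Sum>j\<in>UNIV. \<bar>A $ i $ j\<bar>)"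
      by (rule member_le_sum) (auto simp: sum_nonneg)
    then show "(\<Sum>j\<in>UNIV. \<bar>A $ i $ j\<bar>) < M" by (simp add: M_def)
  qed
  \<comment> \<open>Subspaces are closed here, so approximating \<open>x\<close> from within
    \<open>span D\<close> is enough.\<close>
  have "\<exists>y\<in>span D. dist y x < \<epsilon>" if \<epsilon>: "\<epsilon> > 0" for \<epsilon> :: real
  proof -
    \<comment> \<open>The bound by \<open>M\<close> makes the image of \<open>h\<close> vanish; the
      other keeps the sum of the \<open>CARD('n)\<close> coordinate errors below
      \<open>\<epsilon>\<close>.\<close>
    obtain N :: nat where N: "real N > max M (CARD('n) / \<epsilon>)" using reals_Archimedean2 by blast
    then have "N > 0" "real N > M" using M(1) by linarith+
    obtain q p where q: "0 < q"
      and p: "\<And>k. k < CARD('n) \<Longrightarrow> \<bar>of_int q * x $ e k - of_int (p k)\<bar> < 1 / N"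
      using Dirichlet_approx_simult[OF \<open>N > 0\<close>, of "CARD('n)" "\<lambda>k. x $ e k"] by metis
    define h :: "real ^ 'n" where "h = (\<chi> j. of_int (p (inv_into {0..<CARD('n)} e j)))"
    have close: "\<bar>q * x $ j - h $ j\<bar> < 1 / N" for j
    proof -
      let ?k = "inv_into {0..<CARD('n)} e j"
      have "?k < CARD('n)" using bij_betwE[OF bij_betw_inv_into[OF e]] by auto
      moreover have "e ?k = j" using bij_betw_inv_into_right[OF e] by simp
      ultimately show ?thesis using p[of ?k] by (simp add: h_def)
    qed
    have h_int: "h $ j \<in> \<int>" for j by (simp add: h_def)
    have "(A *v h) $ i = 0" for i
    proof -
      have "(A *v x) $ i = 0" using x by simp
      then have "(\<Sum>j\<in>UNIV. A $ i $ j * (q * x $ j)) = 0"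
        by (simp add: matrix_vector_mult_def mult.left_commute flip: sum_distrib_left)
      then have "(A *v h) $ i = (\<Sum>j\<in>UNIV. A $ i $ j * (h $ j - q * x $ j))"
        by (simp add: matrix_vector_mult_def right_diff_distrib sum_subtractf)
      also have "\<bar>\<dots>\<bar> \<le> (\<Sum>j\<in>UNIV. \<bar>A $ i $ j\<bar> * (1 / N))"
        using close by (intro order_trans[OF sum_abs] sum_mono)
          (simp add: abs_mult mult_left_mono abs_minus_commute less_imp_le del: times_divide_eq_right)
      also have "\<dots> = (\<Sum>j\<in>UNIV. \<bar>A $ i $ j\<bar>) / N" by (simp add: sum_divide_distrib)
      also have "\<dots> < 1" using M(2)[of i] \<open>real N > M\<close> \<open>N > 0\<close> by (simp add: divide_less_eq)
      finally have "\<bar>(A *v h) $ i\<bar> < 1" .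
      moreover have "(A *v h) $ i \<in> \<int>"
        using integral h_int by (auto simp: matrix_vector_mult_def intro!: Ints_sum Ints_mult)
      ultimately show ?thesis using Ints_nonzero_abs_less1 by blast
    qed
    then have "h \<in> span D" using h_int int_kernel by (simp add: vec_eq_iff)
    then have "(1 / q) *\<^sub>R h \<in> span D" by (rule span_scale)
    moreover have "dist ((1 / q) *\<^sub>R h) x < \<epsilon>"
    proof -
      have "\<bar>((1 / q) *\<^sub>R h - x) $ j\<bar> \<le> 1 / N" for j
      proof -
        have "\<bar>((1 / q) *\<^sub>R h - x) $ j\<bar> = \<bar>q * x $ j - h $ j\<bar> / q"
        proof -
          have "((1 / q) *\<^sub>R h - x) $ j = (h $ j - q * x $ j) / q"
            using q by (simp add: field_simps)
          then show ?thesis using q by (simp add: abs_minus_commute)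
        qed
        \<comment> \<open>\<open>q\<close> is a positive integer, so dividing by it does not enlarge
          the error.\<close>
        also have "\<dots> \<le> \<bar>q * x $ j - h $ j\<bar> / 1"
          using q by (intro divide_left_mono) auto
        finally show ?thesis using close[of j] by simp
      qed
      then have "norm ((1 / q) *\<^sub>R h - x) \<le> (\<Sum>j\<in>(UNIV :: 'n set). 1 / N)"
        by (intro order_trans[OF norm_le_l1_cart] sum_mono)
      also have "\<dots> < \<epsilon>" using N \<epsilon> \<open>N > 0\<close> by (simp add: field_simps)
      finally show ?thesis by (simp add: dist_norm)
    qed
    ultimately show ?thesis by blast
  qed
  then have "x \<in> closure (span D)" unfolding closure_approachable by blast
  then show "x \<in> span D" by simp
qed

definition real_vec :: "nat ^ 'n \<Rightarrow> real ^ 'n" where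
  "real_vec u = (\<chi> i. real (u $ i))"

lemma real_vec_nth [simp]: "real_vec u $ i = real (u $ i)"
  by (simp add: real_vec_def)

lemma real_vec_add: "real_vec (u + v) = real_vec u + real_vec v"
  by (simp add: vec_eq_iff)

lemma generator_matrix_mult: "generator_matrix a *v real_vec u = real_vec (factorization_hom a u)"
  by (simp add: vec_eq_iff matrix_vector_mult_def generator_matrix_def factorization_hom_def
      mult.commute)

lemma real_vec_eq_iff [simp]: "real_vec u = real_vec v \<longleftrightarrow> u = v"
  by (simp add: vec_eq_iff)

lemma integral_vec_eq_diff:
  assumes "\<And>i. h $ i \<in> \<int>"
  obtains u v :: "nat ^ 'n::finite" where "h = real_vec u - real_vec v"
proof -
  have "h $ i = real_of_int \<lfloor>h $ i\<rfloor>" for i using assms by simp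
  then have "h $ i = real (nat \<lfloor>h $ i\<rfloor>) - real (nat (- \<lfloor>h $ i\<rfloor>))" for i
    by (cases "\<lfloor>h $ i\<rfloor> \<ge> 0") auto
  then have "h = real_vec (\<chi> i. nat \<lfloor>h $ i\<rfloor>) - real_vec (\<chi> i. nat (- \<lfloor>h $ i\<rfloor>))"
    by (simp add: vec_eq_iff)
  then show ?thesis by (rule that)
qed

definition difference :: "(nat ^ 'n) \<times> (nat ^ 'n) \<Rightarrow> real ^ 'n" where
  "difference = (\<lambda>(u, v). real_vec u - real_vec v)"

section \<open>Relations as a basis of the matrix kernel\<close>

context single_degree_presentation
begin

text \<open>Having a difference in the span is a congruence containing \<open>\<sigma>\<close>,
  which settles integer kernel vectors, each being a difference of natural vectors.
  \<open>kernel_subset_span_integral\<close> passes to real ones.\<close>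

lemma kernel_eq_span:
  "{x. generator_matrix a *v x = 0} = span (difference ` \<sigma>)"
proof
  have relation: "kernel_congruence a \<subseteq> {(u, v). real_vec u - real_vec v \<in> span (difference ` \<sigma>)}"
    (is "_ \<subseteq> ?R")
  proof -
    have "congruence ?R"
    proof (rule congruenceI)
      fix u v w
      show "(v, u) \<in> ?R" if "(u, v) \<in> ?R"
        using span_neg[of "real_vec u - real_vec v"] that by simp
      show "(u, w) \<in> ?R" if "(u, v) \<in> ?R" "(v, w) \<in> ?R"
        using span_add[of "real_vec u - real_vec v" _ "real_vec v - real_vec w"] that by simp
    qed (auto simp: real_vec_add span_zero)
    moreover have "\<sigma> \<subseteq> ?R" by (auto simp: difference_def intro!: span_base)
    ultimately have "congruence hull \<sigma> \<subseteq> ?R" by (intro hull_minimal)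
    then show ?thesis using presentation by (simp add: presentation_def)
  qed
  show "{x. generator_matrix a *v x = 0} \<subseteq> span (difference ` \<sigma>)"
  proof (rule kernel_subset_span_integral)
    show "generator_matrix a $ i $ j \<in> \<int>" for i j by (simp add: generator_matrix_def)
    fix h :: "real ^ 'p" assume "\<And>j. h $ j \<in> \<int>" and h: "generator_matrix a *v h = 0"
    then obtain u v where uv: "h = real_vec u - real_vec v" using integral_vec_eq_diff[of h] by blast
    have "real_vec (factorization_hom a u) = real_vec (factorization_hom a v)"
      using h uv by (simp add: matrix_vector_mult_diff_distrib generator_matrix_mult)
    then show "h \<in> span (difference ` \<sigma>)"
      using relation uv by (auto simp: kernel_congruence_def)
  qed
  show "span (difference ` \<sigma>) \<subseteq> {x. generator_matrix a *v x = 0}"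
  proof (rule span_minimal)
    show "difference ` \<sigma> \<subseteq> {x. generator_matrix a *v x = 0}"
      using presentation_subset[OF presentation]
      by (auto simp: difference_def kernel_congruence_def matrix_vector_mult_diff_distrib
          generator_matrix_mult)
    show "subspace {x. generator_matrix a *v x = 0}"
      by (simp add: subspace_def matrix_vector_right_distrib matrix_vector_mult_scaleR)
  qed
qed

text \<open>By minimality \<open>(u, v)\<close> is outside the congruence \<open>\<rho>\<close>
  generated by the other relations. A linear functional constant on \<open>\<rho>\<close>-classes of
  \<open>Z\<close> kills their differences but not this one.\<close>

lemma difference_notin_span:
  assumes minimal: "\<And>\<tau>. \<tau> \<subset> \<sigma> \<Longrightarrow> \<not> presentation a \<tau>" and uv: "(u, v) \<in> \<sigma>"
  shows "difference (u, v) \<notin> span (difference ` (\<sigma> - {(u, v)}))"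
proof -
  define \<rho> where "\<rho> = congruence hull (\<sigma> - {(u, v)})"
  have \<rho>: "congruence \<rho>" unfolding \<rho>_def by (rule congruence_hull)
  have "(u, v) \<notin> \<rho>"
  proof
    assume "(u, v) \<in> \<rho>"
    then have "congruence hull (insert (u, v) (\<sigma> - {(u, v)})) = \<rho>"
      unfolding \<rho>_def by (rule hull_redundant)
    then have "presentation a (\<sigma> - {(u, v)})"
      using presentation uv by (simp add: presentation_def \<rho>_def insert_absorb)
    then show False using minimal uv by blast
  qed
  \<comment> \<open>The \<open>\<rho>\<close>-class of \<open>u\<close> within \<open>Z\<close>,
    which misses \<open>v\<close>.\<close>
  define C where "C = {w \<in> Z. (u, w) \<in> \<rho>}"
  have Z_pair: "w \<in> Z" "w' \<in> Z" if "(w, w') \<in> \<sigma>" for w w' using that degree by auto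
  \<comment> \<open>One coordinate from its support identifies a member of \<open>Z\<close>, as all
    other members vanish there.\<close>
  have "\<forall>z\<in>Z. \<exists>i. i \<in> supp z" using Z_supp_nonempty by blast
  then obtain j where j: "\<And>z. z \<in> Z \<Longrightarrow> j z \<in> supp z" by metis
  \<comment> \<open>Since supports are disjoint, \<open>\<phi>\<close> is the indicator function of \<open>C\<close> on \<open>Z\<close>, and so separates
    \<open>u\<close> from \<open>v\<close> but respects all other relations.\<close>
  define \<phi> :: "real ^ 'p \<Rightarrow> real" where "\<phi> x = (\<Sum>w\<in>C. x $ j w / w $ j w)" for x
  have "finite C" unfolding C_def using finite_Z by simp
  have \<phi>_Z: "\<phi> (real_vec z) = (if z \<in> C then 1 else 0)" if z: "z \<in> Z" for z
  proof -
    have "real_vec z $ j w / w $ j w = (if w = z then 1 else 0)" if "w \<in> C" for w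
    proof (cases "w = z")
      case True
      then show ?thesis using j[OF z] by (simp add: supp_def)
    next
      case False
      then show ?thesis using Z_disjoint_nonmember[of w z "j w"] j[of w] z that by (simp add: C_def)
    qed
    then have "\<phi> (real_vec z) = (\<Sum>w\<in>C. if w = z then 1 else 0)"
      unfolding \<phi>_def by (intro sum.cong) auto
    then show ?thesis using \<open>finite C\<close> by simp
  qed
  have linear: "\<phi> (x + y) = \<phi> x + \<phi> y" "\<phi> (x - y) = \<phi> x - \<phi> y" "\<phi> (c *\<^sub>R x) = c * \<phi> x" "\<phi> 0 = 0"
    for x y c
    by (simp_all add: \<phi>_def add_divide_distrib diff_divide_distrib sum.distrib sum_subtractf
        sum_distrib_left)
  have "span (difference ` (\<sigma> - {(u, v)})) \<subseteq> {x. \<phi> x = 0}"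
  proof (rule span_minimal)
    show "subspace {x. \<phi> x = 0}" by (simp add: subspace_def linear)
    show "difference ` (\<sigma> - {(u, v)}) \<subseteq> {x. \<phi> x = 0}"
    proof (rule image_subsetI)
      fix r assume r: "r \<in> \<sigma> - {(u, v)}"
      obtain w w' where ww': "r = (w, w')" by fastforce
      with r have w: "(w, w') \<in> \<sigma>" by simp
      have "(w, w') \<in> \<rho>" unfolding \<rho>_def using r ww' by (intro hull_inc) simp
      then have "w \<in> C \<longleftrightarrow> w' \<in> C"
        using Z_pair[OF w] congruence_sym[OF \<rho>] congruence_trans[OF \<rho>] unfolding C_def by blast
      then show "difference r \<in> {x. \<phi> x = 0}"
        using Z_pair[OF w] by (simp add: ww' difference_def linear \<phi>_Z)
    qed
  qed
  moreover have "\<phi> (difference (u, v)) = 1"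
    using Z_pair[OF uv] \<open>(u, v) \<notin> \<rho>\<close> congruence_refl[OF \<rho>]
    by (simp add: difference_def linear \<phi>_Z C_def)
  ultimately show ?thesis by auto
qed

text \<open>By \<open>difference_notin_span\<close> the differences are distinct and independent, so
  \<open>card \<sigma>\<close> is the dimension of the kernel they span.\<close>

lemma card_relations:
  assumes minimal: "\<And>\<tau>. \<tau> \<subset> \<sigma> \<Longrightarrow> \<not> presentation a \<tau>"
  shows "card \<sigma> + rank (generator_matrix a) = CARD('p)"
proof -
  have inj: "inj_on difference \<sigma>"
  proof (rule inj_onI, rule ccontr)
    fix r r' assume r: "r \<in> \<sigma>" "r' \<in> \<sigma>" "difference r = difference r'" "r \<noteq> r'"
    then have "difference r \<in> span (difference ` (\<sigma> - {r}))" by (auto intro!: span_base)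
    then show False using difference_notin_span[OF minimal] r(1) by (cases r) auto
  qed
  have "independent (difference ` \<sigma>)"
    unfolding dependent_def
  proof (intro notI, elim bexE)
    fix x assume x: "x \<in> difference ` \<sigma>" "x \<in> span (difference ` \<sigma> - {x})"
    then obtain r where r: "r \<in> \<sigma>" "x = difference r" by blast
    have "difference ` \<sigma> - {x} = difference ` (\<sigma> - {r})"
      using inj r by (auto simp: inj_on_def)
    then show False using difference_notin_span[OF minimal] r x(2) by (cases r) auto
  qed
  then have "dim (span (difference ` \<sigma>)) = card \<sigma>"
    by (simp add: dim_eq_card_independent card_image[OF inj])
  then show ?thesis using dim_kernel_add_rank[of "generator_matrix a"] by (simp add: kernel_eq_span)
qed

text \<open>A relation with equal entries would have difference \<open>0\<close>, which lies in
  every span. The bound is what an iterated gluing demands.\<close>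

lemma two_le_card_Z:
  assumes minimal: "\<And>\<tau>. \<tau> \<subset> \<sigma> \<Longrightarrow> \<not> presentation a \<tau>" and "\<sigma> \<noteq> {}"
  shows "2 \<le> card Z"
proof -
  obtain u v where uv: "(u, v) \<in> \<sigma>" using assms(2) by auto
  then have "difference (u, v) \<noteq> 0" using difference_notin_span[OF minimal] span_zero by metis
  then have "u \<noteq> v" by (auto simp: difference_def)
  then have "card {u, v} = 2" by simp
  moreover have "{u, v} \<subseteq> Z" using uv degree by auto
  ultimately show ?thesis using card_mono[OF finite_Z] by metis
qed

end

theorem corollary10:
  fixes S :: "(nat ^ 'r::finite) set"
    and a :: "'p::finite \<Rightarrow> nat ^ 'r"
    and d :: "nat ^ 'r"
  assumes "affine_semigroup S"
    and "inj a"
    and "minimally_generates (range a) S"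
    and "d \<in> S" and "d \<noteq> 0"
    and "betti a = {d}"
  shows "presentation a (circuits a) \<and>
    (\<exists>T. is_iterated_gluing S (card (factorizations a d)) T \<and>
         (\<forall>i\<in>{1..card (factorizations a d)}. free_affine_semigroup (T i))) \<and>
    complete_intersection a"
proof -
  \<comment> \<open>The very choice made inside \<open>betti\<close> and
    \<open>min_pres_card\<close>, so both speak of this \<open>\<sigma>\<close>.\<close>
  define \<sigma> where "\<sigma> = (SOME \<sigma>. minimal_presentation a \<sigma>)"
  have min: "minimal_presentation a \<sigma>"
    unfolding \<sigma>_def using minimal_presentation_exists by (rule someI_ex)
  have betti: "{factorization_hom a u | u v. (u, v) \<in> \<sigma>} = {d}"
    using assms(6) by (simp add: betti_def \<sigma>_def Let_def)
  have pres: "presentation a \<sigma>" and minimal: "\<And>\<tau>. \<tau> \<subset> \<sigma> \<Longrightarrow> \<not> presentation a \<tau>"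
    using min by (auto simp: minimal_presentation_def)
  interpret single_degree_presentation a d \<sigma>
  proof
    show "a i \<noteq> 0" for i using minimally_generates_nonzero[OF assms(3)] by (metis rangeI)
    show "\<sigma> \<subseteq> factorizations a d \<times> factorizations a d"
    proof clarify
      fix u v assume uv: "(u, v) \<in> \<sigma>"
      then have "factorization_hom a u = d" using betti by blast
      \<comment> \<open>\<open>betti\<close> records only first entries; membership in the kernel
        carries the degree over to the second.\<close>
      moreover have "factorization_hom a u = factorization_hom a v"
        using uv presentation_subset[OF pres] by (auto simp: kernel_congruence_def)
      ultimately show "u \<in> factorizations a d \<and> v \<in> factorizations a d"
        by (simp add: factorizations_def)
    qed
  qed (use assms(5) pres in auto)
  have "\<sigma> \<noteq> {}" using betti by blast
  then have "2 \<le> card Z" using minimal by (intro two_le_card_Z)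
  moreover have "complete_intersection a"
    using card_relations[OF minimal] by (simp add: complete_intersection_def min_pres_card_def \<sigma>_def)
  ultimately show ?thesis
    using presentation_circuits iterated_gluing[OF assms(2,3)] by blast
qed

end
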